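(* Let $X$ be a topological space. If $X$ is elastic, then $X$ is a $D$-space.
   Context: **$D$-space.** An open neighborhood assignment (ONA) on a space $(X,\tau)$ is a function $N : X \to \tau$ such that $x \in N(x)$ for all $x \in X$. The space $X$ is a $D$-space iff for every ONA $N$ on $X$ there is a closed discrete subset $D$ of $X$ such that $\{N(d) : d \in D\}$ covers $X$. **Pair-base.** A collection $\mathcal{P}$ of ordered pairs $P = (P_1,P_2)$ of subsets of $X$ is a pair-base provided that $P_1$ is open for all $P \in \mathcal{P}$ and for every $x \in X$ and every open set $U$ containing $x$ there is $P \in \mathcal{P}$ such that $x \in P_1 \subseteq P_2 \subseteq U$. **Elastic.** A space $X$ is elastic if there are a pair-base $\mathcal{P}$ on $X$ and a reflexive, transitive relation $\leq$ on $\mathcal{P}$ such that (1) if $P, P' \in \mathcal{P}$ and $P_1 \cap P_1' \neq \emptyset$, then $P \leq P'$ or $P' \leq P$; (2) if $P \in \mathcal{P}$ and $\mathcal{P}' \subseteq \{P' \in \mathcal{P} : P' \leq P\}$, then $\overline{\bigcup\{P_1' : P' \in \mathcal{P}'\}} \subseteq \bigcup\{P_2' : P' \in \mathcal{P}'\}$.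
   Formalization: The space X is additionally assumed to be T1: without this the claim fails, since the two-point indiscrete space is elastic via the single pair (X,X) but its only closed discrete subset is empty; an elastic D-space is always T1. *)

theory Defs
  imports "HOL-Analysis.T1_Spaces"
begin

definition open_nbhd_assignment :: "'a topology \<Rightarrow> ('a \<Rightarrow> 'a set) \<Rightarrow> bool" where
  "open_nbhd_assignment X N \<longleftrightarrow> (\<forall>x\<in>topspace X. openin X (N x) \<and> x \<in> N x)"

definition closed_discrete_in :: "'a topology \<Rightarrow> 'a set \<Rightarrow> bool" where
  "closed_discrete_in X D \<longleftrightarrow> closedin X D \<and> subtopology X D = discrete_topology D"

definition D_space :: "'a topology \<Rightarrow> bool" where
  "D_space X \<longleftrightarrow>
     (\<forall>N. open_nbhd_assignment X N \<longrightarrow>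
        (\<exists>D. closed_discrete_in X D \<and> topspace X \<subseteq> (\<Union>d\<in>D. N d)))"

definition pair_base :: "'a topology \<Rightarrow> ('a set \<times> 'a set) set \<Rightarrow> bool" where
  "pair_base X \<P> \<longleftrightarrow>
     (\<forall>P\<in>\<P>. openin X (fst P) \<and> snd P \<subseteq> topspace X) \<and>
     (\<forall>x U. openin X U \<and> x \<in> U \<longrightarrow>
        (\<exists>P\<in>\<P>. x \<in> fst P \<and> fst P \<subseteq> snd P \<and> snd P \<subseteq> U))"

(* (P, Q) \<in> R stands for P \<le> Q. *)
definition elastic_space :: "'a topology \<Rightarrow> bool" where
  "elastic_space X \<longleftrightarrow>
     (\<exists>\<P> R. pair_base X \<P> \<and> R \<subseteq> \<P> \<times> \<P> \<and> refl_on \<P> R \<and> trans R \<and>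
        (\<forall>P\<in>\<P>. \<forall>Q\<in>\<P>. fst P \<inter> fst Q \<noteq> {} \<longrightarrow> (P, Q) \<in> R \<or> (Q, P) \<in> R) \<and>
        (\<forall>P\<in>\<P>. \<forall>\<Q>. \<Q> \<subseteq> {Q \<in> \<P>. (Q, P) \<in> R} \<longrightarrow>
           X closure_of (\<Union>Q\<in>\<Q>. fst Q) \<subseteq> (\<Union>Q\<in>\<Q>. snd Q)))"

(* An elastic space is regular, since the closure condition applied to a single pair gives
   closure (fst P) <= snd P, but need not be T0, and then it need not be D: the
   indiscrete two-point space X is elastic via the single pair (X, X), but its only
   closed discrete subset is empty. *)

end

theory Submission imports Defs begin

text \<open>
  Given an assignment \<open>N\<close>, choose pairs \<open>p x\<close> of the pair-base with
  \<open>x \<in> fst (p x)\<close> and \<open>snd (p x) \<subseteq> N x\<close>, well-order the pairs, and let \<open>f x\<close> be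
  the first pair above \<open>p x\<close>. Well-order the points lexicographically by \<open>(f x, x)\<close> and
  choose \<open>D\<close> greedily: a point enters \<open>D\<close> unless it is covered by an earlier point of \<open>D\<close>.
  Let \<open>d\<close> be the first point of \<open>D\<close> with \<open>z \<in> N d\<close>; then \<open>d\<close> does not come after \<open>z\<close>,
  and no later point of \<open>D\<close> lies in \<open>N d\<close>. If \<open>e \<in> D\<close> comes before \<open>d\<close> and \<open>fst (p e)\<close>
  meets \<open>fst (p z)\<close>, then either \<open>p e \<le> p z\<close>, or \<open>p z \<le> p e\<close> and hence
  \<open>f e = f z\<close>. So \<open>p e \<le> f z\<close> for all such \<open>e\<close>, and elasticity keeps \<open>z\<close> out of the
  closure of the union of their \<open>fst (p e)\<close>.
\<close>

lemma strict_wellorder_exists: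
  obtains s :: "'b rel" where "wf s" "trans s" "total s"
proof -
  obtain r :: "'b rel" where r: "well_order_on UNIV r"
    using well_order_on by blast
  then have "trans r" "antisym r" "total r" "wf (r - Id)"
    by (auto simp: order_on_defs)
  then have "wf (r - Id)" "trans (r - Id)" "total (r - Id)"
    by (simp_all add: trans_diff_Id)
  then show thesis by (rule that)
qed

text \<open>Whether \<open>x\<close> enters \<open>D\<close> depends only on the points
  \<open>s\<close>-before it, so the indicator of \<open>D\<close> can be defined by well-founded
  recursion.\<close>

lemma wf_kernel_exists:
  assumes "wf s"
  obtains D where "\<And>x. x \<in> D \<longleftrightarrow> x \<in> S \<and> (\<forall>e\<in>D. (e, x) \<in> s \<longrightarrow> \<not> Q e x)"
proof -
  define H where "H = (\<lambda>g x. x \<in> S \<and> (\<forall>e. (e, x) \<in> s \<longrightarrow> g e \<longrightarrow> \<not> Q e x))"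
  have "wfrec s H x \<longleftrightarrow> x \<in> S \<and> (\<forall>e. (e, x) \<in> s \<longrightarrow> wfrec s H e \<longrightarrow> \<not> Q e x)" for x
    by (subst wfrec[OF assms]) (auto simp: H_def cut_apply)
  then show thesis
    by (intro that[of "{x. wfrec s H x}"]) blast
qed

text \<open>Accumulation is a local matter, and in a T1 space a singleton has no accumulation
  points; hence neither has \<open>D\<close>.\<close>

lemma closed_discrete_in_if_locally_subsingleton:
  assumes "t1_space X" and "D \<subseteq> topspace X"
    and "\<And>z. z \<in> topspace X \<Longrightarrow> \<exists>W d. openin X W \<and> z \<in> W \<and> W \<inter> D \<subseteq> {d}"
  shows "closed_discrete_in X D"
proof -
  have "z \<notin> X derived_set_of D" for z
  proof
    assume z: "z \<in> X derived_set_of D"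
    then have "z \<in> topspace X" by (simp add: in_derived_set_of)
    then obtain W d where W: "openin X W" "z \<in> W" "W \<inter> D \<subseteq> {d}"
      using assms(3) by blast
    then have "z \<in> X derived_set_of (W \<inter> D)"
      using z openin_Int_derived_set_of_eq by fastforce
    also have "\<dots> \<subseteq> X derived_set_of {d}"
      using W(3) by (rule derived_set_of_mono)
    also have "\<dots> = {}"
      using assms(1) by (simp add: t1_space_derived_set_of_finite)
    finally show False by simp
  qed
  then have "X derived_set_of D = {}" by blast
  with assms(2) show ?thesis
    by (simp add: closed_discrete_in_def closedin_contains_derived_set
        subtopology_eq_discrete_topology_eq)
qed

theorem theorem6p5:
  fixes X :: "'a topology"
  assumes "t1_space X"
    and "elastic_space X"
  shows "D_space X"
  unfolding D_space_def
proof (intro allI impI)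
  fix N
  assume "open_nbhd_assignment X N"
  then have N: "openin X (N x)" "x \<in> N x" if "x \<in> topspace X" for x
    using that by (auto simp: open_nbhd_assignment_def)
  obtain \<P> R where pb: "pair_base X \<P>" and R: "refl_on \<P> R" "trans R" "R \<subseteq> \<P> \<times> \<P>"
    and ball_comparable: "\<forall>P\<in>\<P>. \<forall>Q\<in>\<P>. fst P \<inter> fst Q \<noteq> {} \<longrightarrow> (P, Q) \<in> R \<or> (Q, P) \<in> R"
    and ball_closure: "\<forall>P\<in>\<P>. \<forall>\<Q>. \<Q> \<subseteq> {Q \<in> \<P>. (Q, P) \<in> R} \<longrightarrow>
           X closure_of (\<Union>Q\<in>\<Q>. fst Q) \<subseteq> (\<Union>Q\<in>\<Q>. snd Q)"
    using assms(2) unfolding elastic_space_def by (elim exE conjE) (rule that)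
  note comparable = ball_comparable[rule_format] and closure = ball_closure[rule_format]
  have "\<forall>x\<in>topspace X. \<exists>P\<in>\<P>. x \<in> fst P \<and> snd P \<subseteq> N x"
    using pb N unfolding pair_base_def by meson
  then obtain p where p: "p x \<in> \<P>" "x \<in> fst (p x)" "snd (p x) \<subseteq> N x"
    if "x \<in> topspace X" for x
    by metis
  obtain s :: "('a set \<times> 'a set) rel" where s: "wf s" "trans s" "total s"
    by (rule strict_wellorder_exists)
  obtain t :: "'a rel" where t: "wf t" "trans t" "total t"
    by (rule strict_wellorder_exists)
  \<comment> \<open>By reflexivity \<open>p x\<close> lies above itself, so there is something to
    minimise.\<close>
  have "\<exists>Q. (p x, Q) \<in> R \<and> (\<forall>Q'. (Q', Q) \<in> s \<longrightarrow> (p x, Q') \<notin> R)" if "x \<in> topspace X" for x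
    using wfE_min[OF s(1), of "p x" "{Q. (p x, Q) \<in> R}"] refl_onD[OF R(1) p(1)[OF that]]
    by (metis mem_Collect_eq)
  then obtain f where
    "\<forall>x\<in>topspace X. (p x, f x) \<in> R \<and> (\<forall>Q'. (Q', f x) \<in> s \<longrightarrow> (p x, Q') \<notin> R)"
    by metis
  then have f: "(p x, f x) \<in> R" "\<And>Q. (Q, f x) \<in> s \<Longrightarrow> (p x, Q) \<notin> R"
    if "x \<in> topspace X" for x
    using that by blast+
  define l where "l = inv_image (s <*lex*> t) (\<lambda>x. (f x, x))"
  have l: "(x, y) \<in> l \<longleftrightarrow> (f x, f y) \<in> s \<or> f x = f y \<and> (x, y) \<in> t" for x y
    by (auto simp: l_def)
  have wf: "wf l" and trans: "trans l"
    using s t by (auto simp: l_def trans_inv_image)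
  have total: "x = y \<or> (x, y) \<in> l \<or> (y, x) \<in> l" for x y
    using s(3) t(3) unfolding l total_on_def by (metis UNIV_I)
  obtain D where D: "\<And>x. x \<in> D \<longleftrightarrow> x \<in> topspace X \<and> (\<forall>e\<in>D. (e, x) \<in> l \<longrightarrow> x \<notin> N e)"
    using wf_kernel_exists[OF wf, of "topspace X" "\<lambda>e x. x \<in> N e"] by blast
  then have DX: "D \<subseteq> topspace X" by blast
  \<comment> \<open>A point of \<open>D\<close> serves as its own \<open>d\<close>; any other
    \<open>z\<close> was rejected because of some earlier \<open>e\<close>, and well-foundedness
    excludes \<open>(z, e) \<in> l\<close>.\<close>
  have covered: "\<exists>d\<in>D. z \<in> N d \<and> (z, d) \<notin> l" if "z \<in> topspace X" for z
    using D[of z] N(2)[OF that] that wf_not_sym[OF wf] wf_not_refl[OF wf] by blast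
  have "\<exists>W d. openin X W \<and> z \<in> W \<and> W \<inter> D \<subseteq> {d}" if z: "z \<in> topspace X" for z
  proof -
    obtain d0 where d0: "d0 \<in> D" "z \<in> N d0" "(z, d0) \<notin> l"
      using covered[OF z] by blast
    obtain d where d: "d \<in> D" "z \<in> N d" and least: "\<And>e. (e, d) \<in> l \<Longrightarrow> e \<in> D \<Longrightarrow> z \<notin> N e"
      using wfE_min[OF wf, of d0 "{d \<in> D. z \<in> N d}"] d0 by (metis (mono_tags, lifting) mem_Collect_eq)
    \<comment> \<open>By leastness \<open>d0\<close> does not precede \<open>d\<close>, so
      \<open>z\<close> before \<open>d\<close> would put \<open>z\<close> before
      \<open>d0\<close>.\<close>
    have zd: "(z, d) \<notin> l"
      using total[of d d0] least[of d0] d0 transD[OF trans, of z d d0] by blast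
    define A where "A = {e \<in> D. (e, d) \<in> l \<and> (p e, f z) \<in> R}"
    define C where "C = X closure_of (\<Union>e\<in>A. fst (p e))"
    have "C \<subseteq> (\<Union>e\<in>A. snd (p e))"
    proof -
      \<comment> \<open>The pair \<open>f z\<close> is the common upper bound that the closure
        condition requires.\<close>
      have "f z \<in> \<P>" "p ` A \<subseteq> {Q \<in> \<P>. (Q, f z) \<in> R}"
        using f(1)[OF z] R(3) unfolding A_def by blast+
      from closure[OF this] show ?thesis
        unfolding C_def by (simp only: image_image)
    qed
    also have "\<dots> \<subseteq> (\<Union>e\<in>A. N e)"
      using p(3) DX unfolding A_def by blast
    finally have zC: "z \<notin> C"
      using least by (auto simp: A_def)
    have open_p: "openin X (fst (p x))" if "x \<in> topspace X" for x
      using pb p(1)[OF that] by (auto simp: pair_base_def)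
    define W where "W = fst (p z) \<inter> N d - C"
    have "openin X W"
      unfolding W_def C_def using open_p[OF z] N(1) d(1) DX
      by (intro openin_diff openin_Int) auto
    moreover have "z \<in> W"
      using p(2)[OF z] d(2) zC by (simp add: W_def)
    moreover have "W \<inter> D \<subseteq> {d}"
    proof
      fix e assume "e \<in> W \<inter> D"
      then have e: "e \<in> D" "e \<in> fst (p z)" "e \<in> N d" "e \<notin> C" "e \<in> topspace X"
        using DX by (auto simp: W_def)
      show "e \<in> {d}"
      proof (rule ccontr)
        assume "e \<notin> {d}"
        then have ed: "(e, d) \<in> l"
          using total[of e d] D[of e] e d(1) D[of d] by blast
        have "(p e, f z) \<in> R"
        proof (cases "(p e, p z) \<in> R")
          case True
          then show ?thesis using f(1)[OF z] transD[OF R(2)] by blast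
        next
          case False
          then have "(p z, p e) \<in> R"
            using comparable[of "p e" "p z"] p(1,2) e z by blast
          then have "(p z, f e) \<in> R"
            using f(1)[OF e(5)] transD[OF R(2)] by blast
          \<comment> \<open>\<open>f e\<close> competes in the minimisation that defines
            \<open>f z\<close>.\<close>
          then have "(f e, f z) \<notin> s"
            using f(2)[OF z] by blast
          \<comment> \<open>Otherwise \<open>z\<close> would precede \<open>e\<close>, and hence
            \<open>d\<close>.\<close>
          moreover have "(f z, f e) \<notin> s"
            using ed zd transD[OF trans, of z e d] l by blast
          ultimately have "f e = f z"
            using s(3) unfolding total_on_def by (metis UNIV_I)
          then show ?thesis using f(1)[OF e(5)] by simp
        qed
        then have "e \<in> A" using e ed by (simp add: A_def)
        then have "(\<Union>e\<in>A. fst (p e)) \<subseteq> topspace X" "e \<in> (\<Union>e\<in>A. fst (p e))"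
          using p(2)[OF e(5)] open_p DX openin_subset[of X] unfolding A_def by blast+
        then have "e \<in> C" unfolding C_def using closure_of_subset by blast
        with e(4) show False by contradiction
      qed
    qed
    ultimately show ?thesis by blast
  qed
  then have "closed_discrete_in X D"
    using closed_discrete_in_if_locally_subsingleton[OF assms(1) DX] by blast
  moreover have "topspace X \<subseteq> (\<Union>d\<in>D. N d)"
    using covered by blast
  ultimately show "\<exists>D. closed_discrete_in X D \<and> topspace X \<subseteq> (\<Union>d\<in>D. N d)" by blast
qed

end
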